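(* Let $M$ be a pointed metric space, let $Y$ be a Banach space, and let $Y_1$ be an absolute summand of $Y$. If $\mathrm{LipSNA}(M,Y)$ is dense in $\mathrm{Lip}_0(M,Y)$, then $\mathrm{LipSNA}(M,Y_1)$ is dense in $\mathrm{Lip}_0(M,Y_1)$.
   Context: All metric spaces are complete and all Banach spaces are real. A pointed metric space is a metric space $(M,d)$ with a distinguished point $0\in M$. $\mathrm{Lip}_0(M,Y)$ is the Banach space of Lipschitz maps $F\colon M\to Y$ with $F(0)=0$, with norm $\|F\|_L=\sup\{\|F(p)-F(q)\|/d(p,q)\colon p\neq q\}$. $F$ strongly attains its norm if there are $p\neq q$ in $M$ with $\|F(p)-F(q)\|/d(p,q)=\|F\|_L$; $\mathrm{LipSNA}(M,Y)$ is the set of such maps. Density is with respect to $\|\cdot\|_L$. An absolute norm is a norm $|\cdot|_a$ on $\mathbb{R}^2$ with $|(1,0)|_a=|(0,1)|_a=1$ and $|(s,t)|_a=|(|s|,|t|)|_a$ for all $s,t\in\mathbb{R}$. For Banach spaces $W,Z$, $W\oplus_a Z$ is $W\times Z$ with the norm $\|(w,z)\|_a=|(\|w\|,\|z\|)|_a$. A closed subspace $Y_1$ of $Y$ is an absolute summand of $Y$ if there are a closed subspace $Z$ of $Y$ and an absolute norm $|\cdot|_a$ such that $Y\equiv Y_1\oplus_a Z$ (isometrically). *)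

theory Defs
  imports "HOL-Analysis.Analysis"
begin

text \<open>
  A complete pointed metric space is a type of class \<open>complete_space\<close> with a base point \<open>o\<^sub>M\<close>.
  The target is a set \<open>S\<close> of vectors (the whole Banach space \<open>UNIV\<close>, or a closed subspace of it);
  \<open>lip0 o\<^sub>M S\<close> is the carrier of Lip_0(M, S).
\<close>

definition lip0 :: "'m::metric_space \<Rightarrow> 'y::real_normed_vector set \<Rightarrow> ('m \<Rightarrow> 'y) set" where
  "lip0 o\<^sub>M S = {F. range F \<subseteq> S \<and> F o\<^sub>M = 0 \<and> (\<exists>L. L-lipschitz_on UNIV F)}"

text \<open>
  The element 0 is inserted because \<open>Sup {}\<close> is unspecified on the reals; it matters only
  when M is a single point, where the norm of Lip_0(M, S) = {0} has to be 0.
\<close>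

definition lip_norm :: "('m::metric_space \<Rightarrow> 'y::real_normed_vector) \<Rightarrow> real" where
  "lip_norm F = Sup (insert 0 {norm (F p - F q) / dist p q |p q. p \<noteq> q})"

definition strongly_attains_norm :: "('m::metric_space \<Rightarrow> 'y::real_normed_vector) \<Rightarrow> bool" where
  "strongly_attains_norm F \<longleftrightarrow> (\<exists>p q. p \<noteq> q \<and> norm (F p - F q) / dist p q = lip_norm F)"

definition lipSNA :: "'m::metric_space \<Rightarrow> 'y::real_normed_vector set \<Rightarrow> ('m \<Rightarrow> 'y) set" where
  "lipSNA o\<^sub>M S = {F \<in> lip0 o\<^sub>M S. strongly_attains_norm F}"

definition lipSNA_dense :: "'m::metric_space \<Rightarrow> 'y::real_normed_vector set \<Rightarrow> bool" where
  "lipSNA_dense o\<^sub>M S \<longleftrightarrow>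
     (\<forall>F \<in> lip0 o\<^sub>M S. \<forall>\<epsilon>>0. \<exists>G \<in> lipSNA o\<^sub>M S. lip_norm (\<lambda>x. F x - G x) < \<epsilon>)"

definition absolute_norm :: "(real \<times> real \<Rightarrow> real) \<Rightarrow> bool" where
  "absolute_norm N \<longleftrightarrow>
     (\<forall>v. 0 \<le> N v) \<and> (\<forall>v. N v = 0 \<longleftrightarrow> v = 0) \<and>
     (\<forall>c v. N (c *\<^sub>R v) = \<bar>c\<bar> * N v) \<and> (\<forall>v w. N (v + w) \<le> N v + N w) \<and>
     N (1, 0) = 1 \<and> N (0, 1) = 1 \<and> (\<forall>s t. N (s, t) = N (\<bar>s\<bar>, \<bar>t\<bar>))"

definition abs_sum_norm ::
    "(real \<times> real \<Rightarrow> real) \<Rightarrow> 'y::real_normed_vector \<times> 'y \<Rightarrow> real" where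
  "abs_sum_norm N = (\<lambda>(w, z). N (norm w, norm z))"

text \<open>
  \<open>J\<close> is an isometric isomorphism from Y onto the absolute sum of \<open>Y\<^sub>1\<close> and \<open>Z\<close>. It is not required
  to be the inverse of addition; \<open>absolute_summandI\<close> below covers the internal direct sum.
\<close>

definition absolute_summand :: "'y::banach set \<Rightarrow> bool" where
  "absolute_summand Y\<^sub>1 \<longleftrightarrow> subspace Y\<^sub>1 \<and> closed Y\<^sub>1 \<and>
     (\<exists>Z N (J :: 'y \<Rightarrow> 'y \<times> 'y). subspace Z \<and> closed Z \<and> absolute_norm N \<and>
        linear J \<and> bij_betw J UNIV (Y\<^sub>1 \<times> Z) \<and> (\<forall>y. abs_sum_norm N (J y) = norm y))"

lemma absolute_summandI:
  fixes Y\<^sub>1 Z :: "'y::banach set"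
  assumes Y1: "subspace Y\<^sub>1" "closed Y\<^sub>1" and Z: "subspace Z" "closed Z" and N: "absolute_norm N"
    and span: "\<And>y. \<exists>w\<in>Y\<^sub>1. \<exists>z\<in>Z. y = w + z"
    and iso: "\<And>w z. w \<in> Y\<^sub>1 \<Longrightarrow> z \<in> Z \<Longrightarrow> norm (w + z) = N (norm w, norm z)"
  shows "absolute_summand Y\<^sub>1"
proof -
  obtain a b where ab: "\<And>y. a y \<in> Y\<^sub>1" "\<And>y. b y \<in> Z" "\<And>y. y = a y + b y"
    using span by metis
  have uniq: "w = w' \<and> z = z'" if "w \<in> Y\<^sub>1" "w' \<in> Y\<^sub>1" "z \<in> Z" "z' \<in> Z" "w + z = w' + z'" for w w' z z'
  proof -
    have "norm ((w - w') + (z - z')) = N (norm (w - w'), norm (z - z'))"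
      using that Y1 Z by (intro iso subspace_diff)
    moreover have "(w - w') + (z - z') = 0" using that(5) by (simp add: algebra_simps)
    ultimately have "(norm (w - w'), norm (z - z')) = 0"
      using N unfolding absolute_norm_def by (metis norm_zero)
    then show ?thesis by (simp add: zero_prod_def)
  qed
  let ?J = "\<lambda>y. (a y, b y)"
  have J: "?J (w + z) = (w, z)" if "w \<in> Y\<^sub>1" "z \<in> Z" for w z
    using uniq[of "a (w + z)" w "b (w + z)" z] ab that by metis
  have "linear ?J"
  proof (rule linearI)
    fix x y
    have "?J ((a x + a y) + (b x + b y)) = (a x + a y, b x + b y)"
      using ab Y1 Z by (intro J subspace_add)
    moreover have "(a x + a y) + (b x + b y) = x + y"
      using ab(3)[of x] ab(3)[of y] by (metis add.assoc add.commute)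
    ultimately show "?J (x + y) = ?J x + ?J y" by simp
  next
    fix c x
    have "?J (c *\<^sub>R a x + c *\<^sub>R b x) = (c *\<^sub>R a x, c *\<^sub>R b x)"
      using ab Y1 Z by (intro J subspace_scale)
    moreover have "c *\<^sub>R a x + c *\<^sub>R b x = c *\<^sub>R x"
      using ab(3)[of x] by (metis scaleR_add_right)
    ultimately show "?J (c *\<^sub>R x) = c *\<^sub>R ?J x" by simp
  qed
  moreover have "bij_betw ?J UNIV (Y\<^sub>1 \<times> Z)"
    by (rule bij_betw_byWitness[where f' = "\<lambda>(w, z). w + z"]) (use ab J in auto)
  moreover have "\<forall>y. abs_sum_norm N (?J y) = norm y"
    using ab iso by (simp add: abs_sum_norm_def) metis
  ultimately show ?thesis
    unfolding absolute_summand_def using Y1 Z N by blast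
qed

end

theory Submission
  imports Defs
begin

text \<open>
  Approximate \<open>F\<close>, seen as a map into \<open>Y\<close>, by a norm-attaining \<open>G\<close> with components \<open>G\<^sub>1\<close>, \<open>G\<^sub>2\<close>;
  then \<open>G\<^sub>2\<close> is small. If \<open>G\<close> attains its norm at \<open>p, q\<close> with component slopes \<open>a, b\<close>, a supporting
  functional \<open>(\<alpha>, \<beta>)\<close> of the absolute norm at \<open>(a, b)\<close> gives the map
  \<open>x \<mapsto> \<alpha> G\<^sub>1 x + \<beta> (\<parallel>G\<^sub>2 x - G\<^sub>2 q\<parallel> - \<parallel>G\<^sub>2 q\<parallel>) u\<close> into \<open>Y\<^sub>1\<close>, where \<open>u\<close> is the direction of \<open>G\<^sub>1 p - G\<^sub>1 q\<close>.
  It has the same norm as \<open>G\<close>, attained at \<open>p, q\<close>. It is close to \<open>G\<^sub>1\<close> because \<open>b\<close> is small,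
  which forces \<open>\<alpha>\<close> to be close to \<open>1\<close>.
\<close>

section \<open>The Lipschitz norm and its attainment\<close>

lemma lip_norm_bound:
  assumes "L-lipschitz_on UNIV F"
  shows "norm (F p - F q) \<le> lip_norm F * dist p q"
proof (cases "p = q")
  case False
  have "x \<le> max 0 L" if "x \<in> insert 0 {norm (F p - F q) / dist p q |p q. p \<noteq> q}" for x
    using that lipschitz_onD[OF assms] by (auto simp: dist_norm divide_le_eq le_max_iff_disj)
  then have "bdd_above (insert 0 {norm (F p - F q) / dist p q |p q. p \<noteq> q})"
    by (rule bdd_aboveI)
  then have "norm (F p - F q) / dist p q \<le> lip_norm F"
    unfolding lip_norm_def using False by (intro cSup_upper) auto
  then show ?thesis using False by (simp add: divide_le_eq)
qed simp

lemma lip_norm_le: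
  assumes "0 \<le> L" and "\<And>p q. norm (F p - F q) \<le> L * dist p q"
  shows "lip_norm F \<le> L"
  unfolding lip_norm_def using assms by (intro cSup_least) (auto simp: divide_le_eq)

text \<open>The constant \<open>c\<close> is identified with the Lipschitz norm on the way: the
  global bound gives one inequality, and the pair \<open>p, q\<close> gives the other.\<close>

lemma strongly_attains_normI:
  assumes "\<And>x y. norm (F x - F y) \<le> c * dist x y"
    and "p \<noteq> q" and "norm (F p - F q) = c * dist p q"
  shows "strongly_attains_norm F"
proof -
  have c: "0 \<le> c"
    using assms(2,3) norm_ge_zero[of "F p - F q"] by (simp add: zero_le_mult_iff)
  then have "c-lipschitz_on UNIV F"
    using assms(1) by (intro lipschitz_onI) (auto simp: dist_norm)
  then have "c * dist p q \<le> lip_norm F * dist p q"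
    using lip_norm_bound assms(3) by metis
  then have "lip_norm F = c"
    using lip_norm_le[OF c assms(1)] assms(2) by simp
  then show ?thesis
    unfolding strongly_attains_norm_def using assms(2,3) by (intro exI[of _ p] exI[of _ q]) simp
qed

section \<open>Absolute norms on the plane\<close>

context
  fixes N :: "real \<times> real \<Rightarrow> real"
  assumes N: "absolute_norm N"
begin

lemma absolute_norm_nonneg: "0 \<le> N v"
  and absolute_norm_eq_0_iff: "N v = 0 \<longleftrightarrow> v = 0"
  and absolute_norm_scaleR: "N (c *\<^sub>R v) = \<bar>c\<bar> * N v"
  and absolute_norm_triangle: "N (v + w) \<le> N v + N w"
  and absolute_norm_10: "N (1, 0) = 1"
  and absolute_norm_01: "N (0, 1) = 1"
  and absolute_norm_abs: "N (s, t) = N (\<bar>s\<bar>, \<bar>t\<bar>)"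
  using N unfolding absolute_norm_def by metis+

lemma absolute_norm_fst: "N (s, 0) = \<bar>s\<bar>"
  using absolute_norm_scaleR[of s "(1, 0)"] absolute_norm_10 by simp

lemma absolute_norm_snd: "N (0, t) = \<bar>t\<bar>"
  using absolute_norm_scaleR[of t "(0, 1)"] absolute_norm_01 by simp

text \<open>The reflected point (s, -t) has the same norm as (s, t), and the two add up to (2s,
  0).\<close>

lemma absolute_norm_ge_fst: "\<bar>s\<bar> \<le> N (s, t)"
  using absolute_norm_triangle[of "(s, t)" "(s, - t)"] absolute_norm_fst[of "2 * s"]
    absolute_norm_abs[of s "- t"] absolute_norm_abs[of s t] by (simp add: abs_mult)

lemma absolute_norm_ge_snd: "\<bar>t\<bar> \<le> N (s, t)"
  using absolute_norm_triangle[of "(s, t)" "(- s, t)"] absolute_norm_snd[of "2 * t"]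
    absolute_norm_abs[of "- s" t] absolute_norm_abs[of s t] by (simp add: abs_mult)

text \<open>Hahn-Banach in the plane: separate the open ball of radius N (a, b) from (a, b),
  normalise, and make the coefficients nonnegative by sign symmetry.\<close>

lemma absolute_norm_supporting_functional:
  assumes "0 \<le> a" "0 \<le> b"
  obtains \<alpha> \<beta> where "0 \<le> \<alpha>" "\<alpha> \<le> 1" "0 \<le> \<beta>" "\<beta> \<le> 1" "\<alpha> * a + \<beta> * b = N (a, b)"
    and "\<And>s t. 0 \<le> s \<Longrightarrow> 0 \<le> t \<Longrightarrow> \<alpha> * s + \<beta> * t \<le> N (s, t)"
proof (cases "(a, b) = 0")
  case True
  then show ?thesis
    using that[of 0 0] absolute_norm_nonneg absolute_norm_eq_0_iff[of "(a, b)"]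
    by (auto simp: zero_prod_def)
next
  case False
  define c where "c = N (a, b)"
  have c: "c > 0"
    using False absolute_norm_nonneg[of "(a, b)"] absolute_norm_eq_0_iff[of "(a, b)"]
    unfolding c_def by linarith
  have conv: "convex {v. N v < c}"
  proof (rule convexI, clarify)
    fix s t s' t' u v :: real
    assume *: "N (s, t) < c" "N (s', t') < c" "0 \<le> u" "0 \<le> v" "u + v = 1"
    have "N (u *\<^sub>R (s, t) + v *\<^sub>R (s', t')) \<le> u * N (s, t) + v * N (s', t')"
      using absolute_norm_triangle[of "u *\<^sub>R (s, t)" "v *\<^sub>R (s', t')"] *
      by (simp only: absolute_norm_scaleR abs_of_nonneg)
    also have "\<dots> < c"
      by (rule convex_bound_lt) (use * in auto)
    finally show "N (u *\<^sub>R (s, t) + v *\<^sub>R (s', t')) < c" .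
  qed
  have N0: "N 0 < c" using c absolute_norm_eq_0_iff[of 0] by simp
  have "\<exists>w k. w \<noteq> 0 \<and> (\<forall>x\<in>{v. N v < c}. w \<bullet> x \<le> k) \<and> (\<forall>x\<in>{(a, b)}. k \<le> w \<bullet> x)"
    using N0 by (intro separating_hyperplane_sets conv) (auto simp: c_def zero_prod_def)
  then obtain w where w: "w \<noteq> 0" "\<And>x. N x < c \<Longrightarrow> w \<bullet> x \<le> w \<bullet> (a, b)"
    by fastforce
  define k where "k = w \<bullet> (a, b)"
  \<comment> \<open>This is the homogeneous form of the separation. Only the open ball is separated,
    so \<open>x\<close> is rescaled to norm r < c, and then r tends to \<open>c\<close>.\<close>
  have le: "c * (w \<bullet> x) \<le> N x * k" for x
  proof -
    have *: "r * (w \<bullet> x) \<le> N x * k" if r: "0 < r" "r < c" for r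
    proof (cases "x = 0")
      case False
      then have pos: "N x > 0"
        using absolute_norm_nonneg[of x] absolute_norm_eq_0_iff[of x] by linarith
      have "N ((r / N x) *\<^sub>R x) < c" using pos r by (simp add: absolute_norm_scaleR)
      then have "w \<bullet> ((r / N x) *\<^sub>R x) \<le> k" unfolding k_def by (rule w(2))
      then show ?thesis using pos by (simp add: field_simps)
    qed (use absolute_norm_eq_0_iff[of 0] in simp)
    have "((\<lambda>r. r * (w \<bullet> x)) \<longlongrightarrow> c * (w \<bullet> x)) (at_left c)"
      by (intro tendsto_intros)
    moreover have "eventually (\<lambda>r. r * (w \<bullet> x) \<le> N x * k) (at_left c)"
      using eventually_at_left_real[OF c] by eventually_elim (use * in auto)
    ultimately show ?thesis by (rule tendsto_upperbound) simp
  qed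
  \<comment> \<open>Testing at \<open>w\<close> itself shows that \<open>k\<close> is positive, so
    the functional can be normalised to take the value \<open>c\<close> at (a, b).\<close>
  have "0 < c * (w \<bullet> w)" using w(1) c by simp
  also have "\<dots> \<le> N w * k" by (rule le)
  finally have k: "k > 0" using absolute_norm_nonneg[of w] by (simp add: zero_less_mult_iff)
  define \<alpha> where "\<alpha> = c * \<bar>fst w\<bar> / k"
  define \<beta> where "\<beta> = c * \<bar>snd w\<bar> / k"
  have nonneg: "0 \<le> \<alpha>" "0 \<le> \<beta>" using c k unfolding \<alpha>_def \<beta>_def by auto
  have bound: "\<alpha> * s + \<beta> * t \<le> N (s, t)" if "0 \<le> s" "0 \<le> t" for s t
  proof -
    \<comment> \<open>Matching the signs of \<open>w\<close> produces the absolute values of its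
      coefficients and leaves \<open>N\<close> unchanged.\<close>
    let ?s = "if fst w \<ge> 0 then s else - s" and ?t = "if snd w \<ge> 0 then t else - t"
    have "w \<bullet> (?s, ?t) = \<bar>fst w\<bar> * s + \<bar>snd w\<bar> * t" by (auto simp: inner_prod_def)
    moreover have "N (?s, ?t) = N (s, t)"
      using absolute_norm_abs[of ?s ?t] that by (simp split: if_splits)
    ultimately have "c * (\<bar>fst w\<bar> * s + \<bar>snd w\<bar> * t) \<le> N (s, t) * k"
      using le[of "(?s, ?t)"] by simp
    then show ?thesis using k by (simp add: \<alpha>_def \<beta>_def field_simps)
  qed
  \<comment> \<open>Since \<open>a\<close> and \<open>b\<close> are nonnegative, taking absolute
    values of the coefficients cannot lower the value at (a, b).\<close>
  have "c * k \<le> c * (\<bar>fst w\<bar> * a + \<bar>snd w\<bar> * b)"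
    using c assms unfolding k_def
    by (intro mult_left_mono) (auto simp: inner_prod_def intro!: add_mono mult_right_mono)
  then have "c \<le> \<alpha> * a + \<beta> * b" using k by (simp add: \<alpha>_def \<beta>_def field_simps)
  then have "\<alpha> * a + \<beta> * b = N (a, b)" using bound[OF assms] c_def by simp
  then show ?thesis
    using that nonneg bound bound[of 1 0] bound[of 0 1] absolute_norm_10 absolute_norm_01 by simp
qed

end

section \<open>Merging two components into one norm-attaining map\<close>

lemma strongly_attaining_from_components:
  fixes G\<^sub>1 :: "'m::metric_space \<Rightarrow> 'y::real_normed_vector" and G\<^sub>2 :: "'m \<Rightarrow> 'z::real_normed_vector"
  assumes N: "absolute_norm N" and S: "subspace S" and G1: "range G\<^sub>1 \<subseteq> S" "G\<^sub>1 o\<^sub>M = 0"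
    and G: "\<And>x y. N (norm (G\<^sub>1 x - G\<^sub>1 y), norm (G\<^sub>2 x - G\<^sub>2 y)) \<le> c * dist x y"
    and pq: "p \<noteq> q" "N (norm (G\<^sub>1 p - G\<^sub>1 q), norm (G\<^sub>2 p - G\<^sub>2 q)) = c * dist p q"
    and G2: "\<And>x y. norm (G\<^sub>2 x - G\<^sub>2 y) \<le> \<delta> * dist x y"
  shows "\<exists>K \<in> lipSNA o\<^sub>M S. \<forall>x y. norm ((G\<^sub>1 x - K x) - (G\<^sub>1 y - K y)) \<le> 2 * \<delta> * dist x y"
proof -
  let ?a = "norm (G\<^sub>1 p - G\<^sub>1 q)" and ?b = "norm (G\<^sub>2 p - G\<^sub>2 q)"
  have d: "dist p q > 0" using pq(1) by simp
  have c: "0 \<le> c"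
    using absolute_norm_nonneg[OF N, of "(?a, ?b)"] pq(2) d by (simp add: zero_le_mult_iff)
  have "0 \<le> \<delta> * dist p q" using G2[of p q] norm_ge_zero by (rule order_trans[rotated])
  then have \<delta>: "0 \<le> \<delta>" using d by (simp add: zero_le_mult_iff)
  have G1c: "norm (G\<^sub>1 x - G\<^sub>1 y) \<le> c * dist x y" for x y
    using absolute_norm_ge_fst[OF N] G[of x y] by (smt (verit) norm_ge_zero)
  show ?thesis
  proof (cases "?a = 0")
    \<comment> \<open>There is no direction \<open>u\<close> here, but all of the norm comes from
      \<open>G\<^sub>2\<close>, so c \<le> \<delta>. Then \<open>G\<^sub>1\<close> itself is small
      and the zero map will do.\<close>
    case True
    then have "c * dist p q = ?b" using pq(2) absolute_norm_snd[OF N] by simp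
    also have "\<dots> \<le> \<delta> * dist p q" by (rule G2)
    finally have "c \<le> \<delta>" using d by simp
    then have "c * dist x y \<le> 2 * \<delta> * dist x y" for x y
      using \<delta> by (intro mult_right_mono) auto
    then have "norm (G\<^sub>1 x - G\<^sub>1 y) \<le> 2 * \<delta> * dist x y" for x y
      using G1c[of x y] by (rule order_trans[rotated])
    moreover have "(\<lambda>x. 0) \<in> lipSNA o\<^sub>M S"
      unfolding lipSNA_def lip0_def
      using S pq(1) strongly_attains_normI[of "\<lambda>x::'m. 0::'y" 0 p q]
      by (auto simp: subspace_0 intro!: exI[of _ 0] lipschitz_onI)
    ultimately show ?thesis by (intro bexI[of _ "\<lambda>x. 0"]) auto
  next
    case False
    obtain \<alpha> \<beta> where ab: "0 \<le> \<alpha>" "\<alpha> \<le> 1" "0 \<le> \<beta>" "\<beta> \<le> 1" "\<alpha> * ?a + \<beta> * ?b = N (?a, ?b)"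
      and le: "\<And>s t. 0 \<le> s \<Longrightarrow> 0 \<le> t \<Longrightarrow> \<alpha> * s + \<beta> * t \<le> N (s, t)"
      using absolute_norm_supporting_functional[OF N, of ?a ?b] by (metis norm_ge_zero)
    define u where "u = (1 / ?a) *\<^sub>R (G\<^sub>1 p - G\<^sub>1 q)"
    \<comment> \<open>The distance to \<open>G\<^sub>2 q\<close> varies no faster than
      \<open>G\<^sub>2\<close> and keeps its full increment between \<open>q\<close> and
      \<open>p\<close>; the constant makes \<open>\<psi>\<close> vanish at the base point.\<close>
    define \<psi> where "\<psi> = (\<lambda>x. norm (G\<^sub>2 x - G\<^sub>2 q) - norm (G\<^sub>2 o\<^sub>M - G\<^sub>2 q))"
    define K where "K = (\<lambda>x. \<alpha> *\<^sub>R G\<^sub>1 x + (\<beta> * \<psi> x) *\<^sub>R u)"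
    have u: "norm u = 1" "G\<^sub>1 p - G\<^sub>1 q = ?a *\<^sub>R u" using False by (auto simp: u_def)
    have uS: "u \<in> S" unfolding u_def using S G1 by (intro subspace_scale subspace_diff) auto
    have \<psi>: "\<bar>\<psi> x - \<psi> y\<bar> \<le> norm (G\<^sub>2 x - G\<^sub>2 y)" for x y
      unfolding \<psi>_def using norm_triangle_ineq3[of "G\<^sub>2 x - G\<^sub>2 q" "G\<^sub>2 y - G\<^sub>2 q"] by simp
    have Kdiff: "K x - K y = \<alpha> *\<^sub>R (G\<^sub>1 x - G\<^sub>1 y) + (\<beta> * (\<psi> x - \<psi> y)) *\<^sub>R u" for x y
      by (simp add: K_def algebra_simps)
    have K\<beta>: "norm ((\<beta> * (\<psi> x - \<psi> y)) *\<^sub>R u) \<le> \<beta> * norm (G\<^sub>2 x - G\<^sub>2 y)" for x y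
      using \<psi>[of x y] ab u by (simp add: abs_mult mult_left_mono)
    have Kc: "norm (K x - K y) \<le> c * dist x y" for x y
    proof -
      have "norm (K x - K y) \<le> \<alpha> * norm (G\<^sub>1 x - G\<^sub>1 y) + \<beta> * norm (G\<^sub>2 x - G\<^sub>2 y)"
        unfolding Kdiff using ab K\<beta>[of x y] by (intro norm_triangle_le add_mono) auto
      also have "\<dots> \<le> N (norm (G\<^sub>1 x - G\<^sub>1 y), norm (G\<^sub>2 x - G\<^sub>2 y))" by (intro le) auto
      finally show ?thesis using G[of x y] by linarith
    qed
    \<comment> \<open>At \<open>p, q\<close> both terms of \<open>K\<close> are nonnegative
      multiples of \<open>u\<close>, so their norms add up to the value of the functional at (?a,
      ?b).\<close>
    have "\<alpha> *\<^sub>R (G\<^sub>1 p - G\<^sub>1 q) = (\<alpha> * ?a) *\<^sub>R u"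
      unfolding scaleR_scaleR[symmetric] using u(2) by (rule arg_cong)
    moreover have "\<psi> p - \<psi> q = ?b" by (simp add: \<psi>_def)
    ultimately have "K p - K q = (\<alpha> * ?a + \<beta> * ?b) *\<^sub>R u"
      unfolding Kdiff by (simp only: scaleR_add_left)
    then have "norm (K p - K q) = \<bar>\<alpha> * ?a + \<beta> * ?b\<bar>" using u(1) by simp
    then have Kpq: "norm (K p - K q) = c * dist p q"
      using ab(5) pq(2) c by simp
    have "K \<in> lipSNA o\<^sub>M S"
      unfolding lipSNA_def lip0_def
    proof (safe intro!: exI[of _ c] lipschitz_onI)
      show "K x \<in> S" for x
        unfolding K_def using S G1 uS by (intro subspace_add subspace_scale) auto
      show "K o\<^sub>M = 0" using G1 by (simp add: K_def \<psi>_def)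
      show "strongly_attains_norm K" using Kc pq(1) Kpq by (rule strongly_attains_normI)
    qed (use c Kc in \<open>auto simp: dist_norm\<close>)
    moreover have "norm ((G\<^sub>1 x - K x) - (G\<^sub>1 y - K y)) \<le> 2 * \<delta> * dist x y" for x y
    proof -
      \<comment> \<open>The first component contributes at most \<alpha> * c * dist p q, so the
        small second one must supply the rest. Only the product (1 - \<alpha>) * c is bounded, which
        suffices because \<open>G\<^sub>1\<close> is \<open>c\<close>-Lipschitz.\<close>
      have "(1 - \<alpha>) * c * dist p q = N (?a, ?b) - \<alpha> * (c * dist p q)"
        using pq(2) by (simp add: algebra_simps)
      also have "\<dots> \<le> \<beta> * ?b"
        using ab(5) mult_left_mono[OF G1c[of p q] ab(1)] by linarith
      also have "\<dots> \<le> ?b" using ab by (simp add: mult_left_le_one_le)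
      also have "\<dots> \<le> \<delta> * dist p q" by (rule G2)
      finally have \<alpha>: "(1 - \<alpha>) * c \<le> \<delta>" using d by simp
      have "(G\<^sub>1 x - K x) - (G\<^sub>1 y - K y) = (1 - \<alpha>) *\<^sub>R (G\<^sub>1 x - G\<^sub>1 y) - (\<beta> * (\<psi> x - \<psi> y)) *\<^sub>R u"
        by (simp add: K_def algebra_simps)
      then have "norm ((G\<^sub>1 x - K x) - (G\<^sub>1 y - K y))
          \<le> (1 - \<alpha>) * norm (G\<^sub>1 x - G\<^sub>1 y) + \<beta> * norm (G\<^sub>2 x - G\<^sub>2 y)"
        using norm_triangle_ineq4[of "(1 - \<alpha>) *\<^sub>R (G\<^sub>1 x - G\<^sub>1 y)" "(\<beta> * (\<psi> x - \<psi> y)) *\<^sub>R u"]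
          K\<beta>[of x y] ab(2) by simp
      also have "\<dots> \<le> (1 - \<alpha>) * (c * dist x y) + 1 * (\<delta> * dist x y)"
        using ab G1c G2 by (intro add_mono mult_mono) auto
      also have "\<dots> \<le> \<delta> * dist x y + \<delta> * dist x y"
        using mult_right_mono[OF \<alpha>, of "dist x y"] by (simp add: mult.assoc)
      finally show ?thesis by simp
    qed
    ultimately show ?thesis by blast
  qed
qed

section \<open>Lifting to the sum and projecting back\<close>

theorem proposition4p5:
  fixes o\<^sub>M :: "'m::complete_space" and Y\<^sub>1 :: "'y::banach set"
  assumes "absolute_summand Y\<^sub>1"
    and "lipSNA_dense o\<^sub>M (UNIV :: 'y set)"
  shows "lipSNA_dense o\<^sub>M Y\<^sub>1"
  unfolding lipSNA_dense_def
proof (intro ballI allI impI)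
  fix F :: "'m \<Rightarrow> 'y" and \<epsilon> :: real
  assume F: "F \<in> lip0 o\<^sub>M Y\<^sub>1" and \<epsilon>: "0 < \<epsilon>"
  obtain Z N and J :: "'y \<Rightarrow> 'y \<times> 'y" where Y1: "subspace Y\<^sub>1" and Z: "subspace Z"
    and N: "absolute_norm N" and J: "linear J" "bij_betw J UNIV (Y\<^sub>1 \<times> Z)"
    and "\<And>y. abs_sum_norm N (J y) = norm y"
    using assms(1) unfolding absolute_summand_def by blast
  then have NJ: "norm y = N (norm (fst (J y)), norm (snd (J y)))" for y
    by (simp add: abs_sum_norm_def case_prod_unfold)
  have J1: "norm (fst (J y)) \<le> norm y" and J2: "norm (snd (J y)) \<le> norm y" for y
    using absolute_norm_ge_fst[OF N] absolute_norm_ge_snd[OF N] NJ[of y]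
    by (metis abs_norm_cancel)+
  note Jdiff = linear_diff[OF J(1)]
  have FY: "F x \<in> Y\<^sub>1" for x using F by (auto simp: lip0_def)
  \<comment> \<open>\<open>J\<close> may send an element w of \<open>Y\<^sub>1\<close> to something
    other than (w, 0), so \<open>F\<close> is pulled back through \<open>J\<close> to a map
    \<open>H\<close> with the same increments in norm.\<close>
  have "\<exists>y. J y = (F x, 0)" for x
    using J(2) FY subspace_0[OF Z] unfolding bij_betw_def by (metis (no_types) SigmaI imageE)
  then obtain H where H: "\<And>x. J (H x) = (F x, 0)" by metis
  obtain L where L: "L-lipschitz_on UNIV F" using F by (auto simp: lip0_def)
  have "norm (H x - H y) = norm (F x - F y)" for x y
    using NJ[of "H x - H y"] absolute_norm_fst[OF N] by (simp add: Jdiff H)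
  then have HL: "L-lipschitz_on UNIV H"
    using L unfolding lipschitz_on_def by (simp add: dist_norm)
  have "norm (H o\<^sub>M) = 0"
    using NJ[of "H o\<^sub>M"] absolute_norm_fst[OF N, of 0] F by (simp add: H lip0_def)
  then have "H \<in> lip0 o\<^sub>M UNIV" using HL by (auto simp: lip0_def)
  \<comment> \<open>One quarter pays for \<open>F\<close> against \<open>G\<^sub>1\<close> and two
    quarters for \<open>G\<^sub>1\<close> against \<open>K\<close>, which leaves a strict
    inequality.\<close>
  moreover have "0 < \<epsilon> / 4" using \<epsilon> by simp
  ultimately obtain G where G: "G \<in> lipSNA o\<^sub>M UNIV" "lip_norm (\<lambda>x. H x - G x) < \<epsilon> / 4"
    using assms(2) unfolding lipSNA_dense_def by blast
  obtain L' where L': "L'-lipschitz_on UNIV G" and G0: "G o\<^sub>M = 0"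
    using G(1) by (auto simp: lipSNA_def lip0_def)
  obtain p q where pq: "p \<noteq> q" "norm (G p - G q) / dist p q = lip_norm G"
    using G(1) by (auto simp: lipSNA_def strongly_attains_norm_def)
  have D: "norm ((H x - G x) - (H y - G y)) \<le> \<epsilon> / 4 * dist x y" for x y
    using lip_norm_bound[OF lipschitz_on_diff[OF HL L'], of x y]
      mult_right_mono[OF less_imp_le[OF G(2)], of "dist x y"] by simp
  define G\<^sub>1 where "G\<^sub>1 = (\<lambda>x. fst (J (G x)))"
  define G\<^sub>2 where "G\<^sub>2 = (\<lambda>x. snd (J (G x)))"
  have NG: "N (norm (G\<^sub>1 x - G\<^sub>1 y), norm (G\<^sub>2 x - G\<^sub>2 y)) = norm (G x - G y)" for x y
    using NJ[of "G x - G y"] by (simp add: Jdiff G\<^sub>1_def G\<^sub>2_def)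
  \<comment> \<open>\<open>J\<close> maps \<open>H x - G x\<close> to (F x -
    \<open>G\<^sub>1\<close> x, - \<open>G\<^sub>2\<close> x), so the single bound \<open>D\<close>
    controls both components.\<close>
  have FG1: "norm ((F x - G\<^sub>1 x) - (F y - G\<^sub>1 y)) \<le> \<epsilon> / 4 * dist x y" for x y
    using order_trans[OF J1 D[of x y]] by (simp add: Jdiff H G\<^sub>1_def)
  have G2: "norm (G\<^sub>2 x - G\<^sub>2 y) \<le> \<epsilon> / 4 * dist x y" for x y
    using order_trans[OF J2 D[of x y]] by (simp add: Jdiff H G\<^sub>2_def norm_minus_commute)
  have "\<exists>K \<in> lipSNA o\<^sub>M Y\<^sub>1. \<forall>x y. norm ((G\<^sub>1 x - K x) - (G\<^sub>1 y - K y)) \<le> 2 * (\<epsilon> / 4) * dist x y"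
  proof (rule strongly_attaining_from_components[OF N Y1 _ _ _ pq(1) _ G2])
    show "range G\<^sub>1 \<subseteq> Y\<^sub>1" using bij_betwE[OF J(2)] by (auto simp: G\<^sub>1_def mem_Times_iff)
    show "G\<^sub>1 o\<^sub>M = 0" using G0 linear_0[OF J(1)] by (simp add: G\<^sub>1_def)
    show "N (norm (G\<^sub>1 x - G\<^sub>1 y), norm (G\<^sub>2 x - G\<^sub>2 y)) \<le> lip_norm G * dist x y" for x y
      unfolding NG by (rule lip_norm_bound[OF L'])
    show "N (norm (G\<^sub>1 p - G\<^sub>1 q), norm (G\<^sub>2 p - G\<^sub>2 q)) = lip_norm G * dist p q"
      unfolding NG using pq by (simp add: divide_eq_eq)
  qed
  then obtain K where K: "K \<in> lipSNA o\<^sub>M Y\<^sub>1"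
    "\<And>x y. norm ((G\<^sub>1 x - K x) - (G\<^sub>1 y - K y)) \<le> 2 * (\<epsilon> / 4) * dist x y" by blast
  have "norm ((F x - K x) - (F y - K y)) \<le> 3 * \<epsilon> / 4 * dist x y" for x y
  proof -
    have "(F x - K x) - (F y - K y)
        = ((F x - G\<^sub>1 x) - (F y - G\<^sub>1 y)) + ((G\<^sub>1 x - K x) - (G\<^sub>1 y - K y))" by simp
    then show ?thesis
      using norm_triangle_mono[OF FG1[of x y] K(2)[of x y]] by (simp add: algebra_simps)
  qed
  then have "lip_norm (\<lambda>x. F x - K x) \<le> 3 * \<epsilon> / 4"
    using \<epsilon> by (intro lip_norm_le) auto
  then show "\<exists>G \<in> lipSNA o\<^sub>M Y\<^sub>1. lip_norm (\<lambda>x. F x - G x) < \<epsilon>"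
    using K(1) \<epsilon> by (intro bexI[of _ K]) auto
qed

end
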